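(* Let $d\ge 1$, let $\zeta$ be an $\mathbb{R}^d$-valued random variable with an arbitrary distribution, and let $N\ge 3$ and $1\le K\le N-2$ be integers. For the Jante's law process with parameters $N,K,\zeta$, with core $\mathcal{X}'(t)$ and $F(t)=G_{N-K}(\mathcal{X}'(t))$, $$\mathbb{P}\left(\{F(t)\to 0 \text{ as } t\to\infty\}\cup\{\mathcal{X}'(t)\to\infty\}\right)=1.$$ In particular, if $\zeta$ has compact support, then $F(t)\to 0$ almost surely.
   Context: Notation: $\|\cdot\|$ is the Euclidean norm on $\mathbb{R}^d$; $B_r(x)$ is the open ball of radius $r$ centred at $x$; $\operatorname{supp}\zeta=\{x\in\mathbb{R}^d:\ \mathbb{P}(\zeta\in B_\varepsilon(x))>0\ \forall\varepsilon>0\}$. For points $x_1,\dots,x_n\in\mathbb{R}^d$ let $\mu_n(x_1,\dots,x_n)=\frac1n\sum_{i=1}^n x_i$ and $G_n(x_1,\dots,x_n)=\frac1n\sum_{i=1}^n\sum_{j=1}^{i-1}\|x_i-x_j\|^2=\sum_{i=1}^n\|x_i-\mu_n\|^2$. Core: given a configuration (finite multiset) of $N$ points, its core is a subconfiguration of $N-K$ of these points which minimizes $G_{N-K}$ among all subconfigurations of size $N-K$; if there are several minimizers, one of them is chosen with equal probability. Jante's law process with parameters $N,K,\zeta$: the initial configuration $\mathcal{X}(0)$ consists of $N$ distinct points of $\operatorname{supp}\zeta$ (arbitrary or random). Let $\zeta_{t;j}$, $t=1,2,\dots$, $j=1,\dots,K$, be i.i.d. with the distribution of $\zeta$, independent of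 the initial configuration. Given $\mathcal{X}(t)$, let $\mathcal{X}'(t)$ be its core, and set $\mathcal{X}(t+1)=\mathcal{X}'(t)\cup\{\zeta_{t+1;1},\dots,\zeta_{t+1;K}\}$ (points counted with multiplicity). We write $\mathcal{X}'(t)\to\infty$ if $\min\{\|x\|:\ x\in\mathcal{X}'(t)\}\to\infty$ as $t\to\infty$. *)

theory Defs
  imports "HOL-Probability.Probability" "HOL-Library.Multiset"
begin

definition mean_mset :: "'a::real_vector multiset \<Rightarrow> 'a" where
  "mean_mset C = (1 / real (size C)) *\<^sub>R sum_mset C"

definition G :: "'a::real_normed_vector multiset \<Rightarrow> real" where
  "G C = (\<Sum>x\<in>#C. (norm (x - mean_mset C))\<^sup>2)"

lemma sum_pairwise_sq_dist:
  fixes f :: "nat \<Rightarrow> 'a::real_inner"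
  shows "(\<Sum>i<n. \<Sum>j<i. (norm (f i - f j))\<^sup>2)
    = real n * (\<Sum>i<n. (norm (f i))\<^sup>2) - (norm (\<Sum>i<n. f i))\<^sup>2"
proof (induction n)
  case (Suc n)
  let ?S = "\<Sum>i<n. f i"
  have "(\<Sum>j<n. (norm (f n - f j))\<^sup>2)
      = real n * (norm (f n))\<^sup>2 - 2 * (f n \<bullet> ?S) + (\<Sum>j<n. (norm (f j))\<^sup>2)"
    by (simp add: power2_norm_eq_inner inner_diff_left inner_diff_right inner_commute
        sum.distrib sum_subtractf inner_sum_right sum_distrib_left algebra_simps)
  moreover have "(norm (?S + f n))\<^sup>2 = (norm ?S)\<^sup>2 + 2 * (f n \<bullet> ?S) + (norm (f n))\<^sup>2"
    by (simp add: power2_norm_eq_inner inner_add_left inner_add_right inner_commute)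
  ultimately show ?case
    using Suc by (simp add: algebra_simps)
qed simp

text \<open>The two expressions for the functional agree: the sum of squared distances to the mean is
  the normalised sum of squared pairwise distances.\<close>

lemma G_mset_pairwise:
  fixes xs :: "'a::real_inner list"
  shows "G (mset xs)
    = 1 / real (length xs) * (\<Sum>i<length xs. \<Sum>j<i. (norm (xs ! i - xs ! j))\<^sup>2)"
proof (cases "xs = []")
  case True
  then show ?thesis by (simp add: G_def)
next
  case False
  define n where "n = length xs"
  define S where "S = (\<Sum>i<n. xs ! i)"
  have n: "real n > 0" using False by (simp add: n_def)
  have idx: "(\<Sum>x\<in>#mset xs. h x) = (\<Sum>i<n. h (xs ! i))" for h :: "'a \<Rightarrow> 'b::comm_monoid_add"
    by (metis (no_types, lifting) atLeast0LessThan mset_map n_def sum_list_sum_nth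
        sum_mset_sum_list length_map nth_map sum.cong lessThan_iff)
  have mean: "mean_mset (mset xs) = (1 / real n) *\<^sub>R S"
    using idx[of "\<lambda>x. x"] by (simp add: mean_mset_def S_def n_def)
  have "G (mset xs) = (\<Sum>i<n. (norm (xs ! i - (1 / real n) *\<^sub>R S))\<^sup>2)"
    by (simp only: G_def mean idx)
  also have "\<dots> = (\<Sum>i<n. (norm (xs ! i))\<^sup>2 - 2 / real n * (xs ! i \<bullet> S) + (norm S)\<^sup>2 / (real n)\<^sup>2)"
    unfolding power2_norm_eq_inner
    using n by (intro sum.cong refl)
      (simp add: inner_diff_left inner_diff_right inner_commute power2_eq_square field_simps)
  also have "\<dots> = (\<Sum>i<n. (norm (xs ! i))\<^sup>2) - 2 / real n * (S \<bullet> S) + real n * ((norm S)\<^sup>2 / (real n)\<^sup>2)"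
    by (simp add: sum.distrib sum_subtractf S_def inner_sum_left sum_distrib_left sum_divide_distrib)
  also have "\<dots> = 1 / real n * (real n * (\<Sum>i<n. (norm (xs ! i))\<^sup>2) - (norm S)\<^sup>2)"
    using n by (simp add: dot_square_norm field_simps power2_eq_square)
  finally show ?thesis
    using sum_pairwise_sq_dist[of "(!) xs" n] by (simp add: n_def S_def)
qed

text \<open>A subconfiguration is a submultiset, so two selections of labelled points that give the same
  multiset count as one minimizer.\<close>

definition cores :: "nat \<Rightarrow> 'a::real_normed_vector multiset \<Rightarrow> 'a multiset set" where
  "cores n X = {C. is_arg_min G (\<lambda>D. D \<subseteq># X \<and> size D = n) C}"

lemma finite_submultisets: "finite {C. C \<subseteq># X}"
proof (rule finite_subset)
  show "{C. C \<subseteq># X} \<subseteq> mset ` {ys. set ys \<subseteq> set_mset X \<and> length ys \<le> size X}"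
  proof
    fix C assume C: "C \<in> {C. C \<subseteq># X}"
    obtain ys where "mset ys = C" using ex_mset by blast
    with C have "set ys \<subseteq> set_mset X \<and> length ys \<le> size X"
      by (metis mem_Collect_eq set_mset_mono set_mset_mset size_mset size_mset_mono)
    with \<open>mset ys = C\<close> show "C \<in> mset ` {ys. set ys \<subseteq> set_mset X \<and> length ys \<le> size X}"
      by blast
  qed
  show "finite (mset ` {ys. set ys \<subseteq> set_mset X \<and> length ys \<le> size X})"
    by (intro finite_imageI finite_lists_length_le) simp
qed

lemma finite_cores: "finite (cores n X)"
proof (rule finite_subset)
  show "cores n X \<subseteq> {C. C \<subseteq># X}" by (auto simp: cores_def is_arg_min_def)
  show "finite {C. C \<subseteq># X}" by (rule finite_submultisets)
qed

lemma cores_nonempty: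
  assumes "n \<le> size X"
  shows "cores n X \<noteq> {}"
proof -
  let ?D = "{D. D \<subseteq># X \<and> size D = n}"
  have fin: "finite ?D" by (rule finite_subset[OF _ finite_submultisets]) auto
  obtain xs where xs: "mset xs = X" using ex_mset by blast
  have "mset (take n xs) \<subseteq># X"
    by (metis append_take_drop_id mset_append mset_subset_eq_add_left xs)
  moreover have "size (mset (take n xs)) = n" using assms xs by auto
  ultimately have "?D \<noteq> {}" by blast
  from arg_min_if_finite[OF fin this, of G] show ?thesis
    by (auto simp: cores_def is_arg_min_def intro!: exI[of _ "arg_min_on G ?D"])
qed

definition rv_support :: "'p measure \<Rightarrow> ('p \<Rightarrow> 'a::metric_space) \<Rightarrow> 'a set" where
  "rv_support P \<zeta> = {x. \<forall>\<epsilon>>0. \<P>(\<omega> in P. \<zeta> \<omega> \<in> ball x \<epsilon>) > 0}"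

text \<open>The usual \<open>\<sigma>\<close>-algebra for random finite configurations: the one generated by
  the numbers of points, counted with multiplicity, in Borel sets.\<close>

definition config_space :: "'a::topological_space multiset measure" where
  "config_space = sigma UNIV
     {{X. size (filter_mset (\<lambda>x. x \<in> B) X) = k} | B k. B \<in> sets borel}"

text \<open>\<open>X t\<close> is the configuration and \<open>C t\<close> its core at time \<open>t\<close>; \<open>Z t j\<close> are the new points
  (\<open>t \<ge> 1\<close>, \<open>1 \<le> j \<le> K\<close>). \<open>history M K X C Z t u\<close> is the \<open>\<sigma>\<close>-algebra generated by the initial
  configuration, the new points arriving up to time \<open>t\<close> and the cores chosen before time \<open>u\<close>.\<close>

definition history :: "'w measure \<Rightarrow> nat \<Rightarrow> (nat \<Rightarrow> 'w \<Rightarrow> 'a::topological_space multiset) \<Rightarrow>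
    (nat \<Rightarrow> 'w \<Rightarrow> 'a multiset) \<Rightarrow> (nat \<Rightarrow> nat \<Rightarrow> 'w \<Rightarrow> 'a) \<Rightarrow> nat \<Rightarrow> nat \<Rightarrow> 'w measure" where
  "history M K X C Z t u = sigma (space M)
     (sets (vimage_algebra (space M) (X 0) config_space)
      \<union> (\<Union>s\<in>{1..t}. \<Union>j\<in>{1..K}. sets (vimage_algebra (space M) (Z s j) borel))
      \<union> (\<Union>s\<in>{..<u}. sets (vimage_algebra (space M) (C s) config_space)))"

definition future :: "'w measure \<Rightarrow> nat \<Rightarrow> (nat \<Rightarrow> nat \<Rightarrow> 'w \<Rightarrow> 'a::topological_space) \<Rightarrow>
    nat \<Rightarrow> 'w measure" where
  "future M K Z t = sigma (space M)
     (\<Union>s\<in>{t<..}. \<Union>j\<in>{1..K}. sets (vimage_algebra (space M) (Z s j) borel))"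

text \<open>Assumption \<open>indep_history\<close> says that later new points are independent of the initial
  configuration and of all earlier new points and choices of cores. Assumption \<open>uniform_core\<close>
  says that, given everything that happened before the choice at time \<open>t\<close>, the core is uniformly
  distributed on the finite set of minimizers.\<close>

locale jante_process = prob_space M
  for M :: "'w measure" and P :: "'p measure" and \<zeta> :: "'p \<Rightarrow> 'a::euclidean_space"
    and N K :: nat
    and X C :: "nat \<Rightarrow> 'w \<Rightarrow> 'a multiset" and Z :: "nat \<Rightarrow> nat \<Rightarrow> 'w \<Rightarrow> 'a" +
  assumes measurable_init: "X 0 \<in> M \<rightarrow>\<^sub>M config_space"
    and measurable_core: "\<And>t. C t \<in> M \<rightarrow>\<^sub>M config_space"
    and measurable_new: "\<And>t j. t \<ge> 1 \<Longrightarrow> j \<in> {1..K} \<Longrightarrow> Z t j \<in> borel_measurable M"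
    and init: "AE \<omega> in M. size (X 0 \<omega>) = N \<and> card (set_mset (X 0 \<omega>)) = N \<and>
                 set_mset (X 0 \<omega>) \<subseteq> rv_support P \<zeta>"
    and distr_new: "\<And>t j. t \<ge> 1 \<Longrightarrow> j \<in> {1..K} \<Longrightarrow> distr M borel (Z t j) = distr P borel \<zeta>"
    and indep_new: "indep_vars (\<lambda>_. borel) (\<lambda>(t, j). Z t j) ({1..} \<times> {1..K})"
    and indep_history: "\<And>t. indep_set (sets (history M K X C Z t (Suc t))) (sets (future M K Z t))"
    and core: "\<And>t. AE \<omega> in M. C t \<omega> \<in> cores (N - K) (X t \<omega>)"
    and uniform_core: "\<And>t A. A \<in> sets config_space \<Longrightarrow>
          AE \<omega> in M. real_cond_exp M (history M K X C Z t t) (indicator (C t -` A \<inter> space M)) \<omega>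
            = measure_pmf.prob (pmf_of_set (cores (N - K) (X t \<omega>))) A"
    and step: "\<And>t \<omega>. \<omega> \<in> space M \<Longrightarrow>
          X (Suc t) \<omega> = C t \<omega> + image_mset (\<lambda>j. Z (Suc t) j \<omega>) (mset_set {1..K})"

definition tends_to_infinity :: "(nat \<Rightarrow> 'a::real_normed_vector multiset) \<Rightarrow> bool" where
  "tends_to_infinity Y \<longleftrightarrow> filterlim (\<lambda>t. Min (norm ` set_mset (Y t))) at_top sequentially"

end

theory Submission imports Defs begin

text \<open>
  Write \<open>n = N - K\<close> and \<open>F(t) = G (C t)\<close>. The old core is one of the competitors for the new
  one, so \<open>F\<close> is nonincreasing. More is true: replacing a point \<open>x\<close> of the core by a
  single new point \<open>y\<close> gives another competitor, and with \<open>m\<close> the mean of the core this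
  lowers \<open>G\<close> by exactly
  \<open>|x - m|\<^sup>2 - |y - m|\<^sup>2 + |x - y|\<^sup>2 / n\<close> (\<open>exchange_gain\<close>, \<open>G_exchange\<close>). If \<open>x\<close> is the point of
  the core farthest from the mean and \<open>y\<close> the point of the core farthest from \<open>x\<close>, this gain is
  at least \<open>F(t) / n\<^sup>2\<close> (\<open>ex_exchange_gain\<close>). By continuity, a new point that merely lands near
  such a \<open>y\<close> also lowers \<open>F\<close>; and since \<open>y\<close> lies in the support of \<open>\<zeta>\<close>, this has positive
  probability.

  The second ingredient says that a fixed opportunity of this kind does not recur. Let \<open>U\<close>, \<open>V\<close>,
  \<open>W\<close> be open, let the gain be at least \<open>\<delta> > 0\<close> for \<open>m\<close>, \<open>x\<close>, \<open>y\<close> in them, and let \<open>\<zeta>\<close> hit \<open>W\<close>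
  with probability \<open>p > 0\<close>. Whenever the mean lies in \<open>U\<close>, the core meets \<open>V\<close> and the next new
  point falls in \<open>W\<close>, \<open>F\<close> drops by at least \<open>\<delta>\<close>, which happens at most \<open>F(0) / \<delta>\<close> times.
  The new point is independent of the past, so taking expectations on \<open>{F(0) \<le> L}\<close> gives
  \<open>\<Sum>\<^sub>t p P(mean in U, core meets V, F(0) \<le> L) \<le> L / \<delta>\<close>, and by Borel-Cantelli almost surely the
  mean is in \<open>U\<close> while the core meets \<open>V\<close> at only finitely many times (\<open>AE_eventually_avoids\<close>).

  Now restrict to \<open>U\<close>, \<open>V\<close>, \<open>W\<close> from a countable base, so that one null set serves for all of
  them. On a path where \<open>F\<close> does not tend to 0 and the core does not tend to infinity, the
  diameters stay bounded because \<open>F\<close> does, so along some subsequence \<open>m\<close>, \<open>x\<close> and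
  \<open>y\<close> stay bounded with gains bounded away from 0. They accumulate at a triple with positive gain
  (\<open>ex_recurrent_gain\<close>), and small basic neighbourhoods of that triple are visited
  infinitely often, which has been excluded.
\<close>

section \<open>Measurable functions of configurations\<close>

lemma space_config_space [simp]: "space config_space = UNIV"
  by (simp add: config_space_def)

lemma measurable_size_filter:
  assumes "B \<in> sets borel"
  shows "(\<lambda>X. size (filter_mset (\<lambda>x. x \<in> B) X)) \<in> measurable config_space (count_space UNIV)"
proof -
  have "{X. size (filter_mset (\<lambda>x. x \<in> B) X) = k} \<in> sets config_space" for k
    using assms by (auto simp: config_space_def intro!: sigma_sets.Basic)
  then show ?thesis
    by (simp add: measurable_count_space_eq2_countable vimage_def)
qed

lemma measurable_meets:
  assumes "B \<in> sets borel"
  shows "{X. set_mset X \<inter> B \<noteq> {}} \<in> sets config_space"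
proof -
  have "{X. set_mset X \<inter> B \<noteq> {}}
      = (\<lambda>X. size (filter_mset (\<lambda>x. x \<in> B) X)) -` {0<..} \<inter> space config_space"
    by (auto simp: nonempty_has_size[symmetric] filter_mset_eq_mempty_iff)
  also have "\<dots> \<in> sets config_space"
    using measurable_size_filter[OF assms] by (rule measurable_sets) simp
  finally show ?thesis .
qed

text \<open>For a nonempty configuration, the minimal norm is below \<open>c\<close> iff the configuration meets the ball
  of radius \<open>c\<close>. The empty one is treated apart, with the unspecified value \<open>Min {}\<close>.\<close>

lemma measurable_Min_norm [measurable]:
  "(\<lambda>X. Min (norm ` set_mset X)) \<in>
    borel_measurable (config_space :: 'a::euclidean_space multiset measure)"
proof (rule borel_measurableI_less)
  fix c :: real
  have ne: "{X :: 'a multiset. set_mset X \<inter> UNIV \<noteq> {}} \<in> sets config_space"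
    by (rule measurable_meets) simp
  have "{X. set_mset X \<inter> ball (0::'a) c \<noteq> {}} \<in> sets config_space"
    by (rule measurable_meets) simp
  moreover have "{X :: 'a multiset. X = {#} \<and> Min {} < c} \<in> sets config_space"
    using sets.compl_sets[OF ne] by (cases "Min {} < c") (auto simp: Compl_eq_Diff_UNIV[symmetric] Collect_neg_eq[symmetric])
  moreover have "{X \<in> space config_space. Min (norm ` set_mset X) < c}
      = {X. set_mset X \<inter> ball (0::'a) c \<noteq> {}} \<union> {X. X = {#} \<and> Min {} < c}" (is "?L = ?R")
  proof -
    have "X \<in> ?L \<longleftrightarrow> X \<in> ?R" for X :: "'a multiset"
      by (cases "X = {#}") (auto simp: Min_less_iff disjoint_iff)
    then show ?thesis by blast
  qed
  ultimately show "{X \<in> space config_space. Min (norm ` set_mset (X :: 'a multiset)) < c} \<in> sets config_space"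
    by simp
qed

text \<open>The \<open>\<sigma>\<close>-algebra on configurations makes the counts of points in Borel sets measurable, that
  is, the sums of indicator functions; other sums are reached by monotone approximation.\<close>

lemma measurable_sum_mset_ennreal:
  fixes f :: "'a::topological_space \<Rightarrow> ennreal"
  assumes "f \<in> borel_measurable borel"
  shows "(\<lambda>X. \<Sum>x\<in>#X. f x) \<in> borel_measurable config_space"
  using assms
proof (induction rule: borel_measurable_induct)
  case (cong f g)
  then show ?case by simp
next
  case (set A)
  have "(\<Sum>x\<in>#X. indicator A x :: ennreal) = of_nat (size (filter_mset (\<lambda>x. x \<in> A) X))" for X
    by (induction X) auto
  moreover have "(\<lambda>X. of_nat (size (filter_mset (\<lambda>x. x \<in> A) X)) :: ennreal) \<in> borel_measurable config_space"
    using measurable_size_filter[OF set] by measurable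
  ultimately show ?case by simp
next
  case (mult u c)
  then show ?case by (simp flip: sum_mset_distrib_left)
next
  case (add u v)
  then show ?case by (simp add: sum_mset.distrib)
next
  case (seq U)
  have "(\<Sum>x\<in>#X. (SUP i. U i) x) = (SUP i. \<Sum>x\<in>#X. U i x)" for X
  proof (induction X)
    case (add a X)
    have "incseq (\<lambda>i. U i a)" using seq.hyps by (auto simp: incseq_def le_fun_def)
    moreover have "incseq (\<lambda>i. \<Sum>x\<in>#X. U i x)" using seq.hyps
      by (auto simp: incseq_def le_fun_def intro!: sum_mset_mono)
    ultimately have "(SUP i. U i a + (\<Sum>x\<in>#X. U i x)) = (SUP i. U i a) + (SUP i. \<Sum>x\<in>#X. U i x)"
      by (rule ennreal_SUP_add)
    moreover have "(\<Sum>x\<in>#add_mset a X. (SUP i. U i) x) = (SUP i. U i a) + (\<Sum>x\<in>#X. (SUP i. U i) x)"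
      by (simp add: image_comp)
    ultimately show ?case
      by (simp only: add.IH image_mset_add_mset sum_mset.add_mset)
  qed auto
  moreover have "(\<lambda>X. SUP i. \<Sum>x\<in>#X. U i x) \<in> borel_measurable config_space"
    using seq.IH by measurable
  ultimately show ?case by simp
qed

lemma measurable_sum_mset [measurable]:
  fixes f :: "'a::topological_space \<Rightarrow> real"
  assumes [measurable]: "f \<in> borel_measurable borel"
  shows "(\<lambda>X. \<Sum>x\<in>#X. f x) \<in> borel_measurable config_space"
proof -
  have nonneg: "(\<lambda>X. \<Sum>x\<in>#X. g x) \<in> borel_measurable config_space"
    if [measurable]: "g \<in> borel_measurable borel" and g: "\<And>x. g x \<ge> 0" for g :: "'a \<Rightarrow> real"
  proof -
    have *: "ennreal (\<Sum>x\<in>#X. g x) = (\<Sum>x\<in>#X. ennreal (g x)) \<and> 0 \<le> (\<Sum>x\<in>#X. g x)" for X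
      by (induction X) (auto simp: g ennreal_plus)
    have "(\<Sum>x\<in>#X. g x) = enn2real (\<Sum>x\<in>#X. ennreal (g x))" for X
      using *[of X] by (metis enn2real_ennreal)
    moreover have "(\<lambda>X. enn2real (\<Sum>x\<in>#X. ennreal (g x))) \<in> borel_measurable config_space"
      by (intro borel_measurable_enn2real measurable_sum_mset_ennreal) measurable
    ultimately show ?thesis by simp
  qed
  have "(\<Sum>x\<in>#X. f x) = (\<Sum>x\<in>#X. max 0 (f x)) - (\<Sum>x\<in>#X. max 0 (- f x))" for X
    by (induction X) auto
  moreover have "(\<lambda>X. (\<Sum>x\<in>#X. max 0 (f x)) - (\<Sum>x\<in>#X. max 0 (- f x))) \<in> borel_measurable config_space"
    by (intro borel_measurable_diff nonneg) auto
  ultimately show ?thesis by simp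
qed

lemma measurable_size_mset [measurable]:
  "(\<lambda>X. real (size X)) \<in> borel_measurable (config_space :: 'a::topological_space multiset measure)"
  using measurable_sum_mset[of "\<lambda>_::'a. 1"] by simp

lemma inner_sum_mset: "(\<Sum>\<^sub># X) \<bullet> b = (\<Sum>x\<in>#X. x \<bullet> b)"
  for b :: "'a::real_inner"
  by (induction X) (auto simp: inner_add_left)

lemma measurable_mean_mset [measurable]:
  "mean_mset \<in> borel_measurable (config_space :: 'a::euclidean_space multiset measure)"
proof (rule borel_measurable_euclidean_space[THEN iffD2, rule_format])
  fix i :: 'a assume "i \<in> Basis"
  show "(\<lambda>X. mean_mset X \<bullet> i) \<in> borel_measurable config_space"
    by (simp add: mean_mset_def inner_sum_mset) measurable
qed

text \<open>The parallel axis theorem.\<close>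

lemma sum_mset_sq_dist:
  fixes C :: "'a::real_inner multiset"
  shows "(\<Sum>x\<in>#C. (norm (x - c))\<^sup>2) = G C + real (size C) * (norm (c - mean_mset C))\<^sup>2"
proof -
  have shift: "(\<Sum>x\<in>#D. (norm (x - c))\<^sup>2)
      = (\<Sum>x\<in>#D. (norm (x - m))\<^sup>2) + 2 * ((m - c) \<bullet> (\<Sum>\<^sub># D - real (size D) *\<^sub>R m))
        + real (size D) * (norm (c - m))\<^sup>2" for D and m :: 'a
    by (induction D) (auto simp: power2_norm_eq_inner inner_diff_left inner_diff_right
          inner_add_left inner_add_right inner_commute algebra_simps)
  have "\<Sum>\<^sub># C = real (size C) *\<^sub>R mean_mset C"
    by (cases "C = {#}") (auto simp: mean_mset_def)
  then show ?thesis using shift[of C "mean_mset C"] by (simp add: G_def)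
qed

lemma sum_mset_sq_dist_nonneg: "0 \<le> (\<Sum>x\<in>#C. (norm (x - c))\<^sup>2)"
  by (induction C) auto

lemma G_nonneg: "G C \<ge> 0"
  by (simp add: G_def sum_mset_sq_dist_nonneg)

lemma G_eq: "G C = (\<Sum>x\<in>#C. (norm x)\<^sup>2) - real (size C) * (norm (mean_mset C))\<^sup>2"
  for C :: "'a::real_inner multiset"
  using sum_mset_sq_dist[of 0 C] by simp

lemma measurable_G [measurable]:
  "G \<in> borel_measurable (config_space :: 'a::euclidean_space multiset measure)"
  unfolding G_eq[abs_def] by measurable

section \<open>Exchanging one point of a configuration\<close>

text \<open>The amount by which \<open>G\<close> decreases when the point \<open>x\<close> of a configuration of size \<open>n\<close> with
  mean \<open>m\<close> is replaced by \<open>y\<close>; see \<open>G_exchange\<close>.\<close>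

definition exchange_gain :: "nat \<Rightarrow> 'a::real_inner \<Rightarrow> 'a \<Rightarrow> 'a \<Rightarrow> real" where
  "exchange_gain n m x y = (norm (x - m))\<^sup>2 - (norm (y - m))\<^sup>2 + (norm (x - y))\<^sup>2 / real n"

text \<open>Around the old mean, the sum of squared distances changes by the contributions of \<open>x\<close> and \<open>y\<close>
  only. The mean moves by \<open>(y - x) / n\<close>, and passing to the new mean saves another
  \<open>n |(y - x) / n|\<^sup>2\<close>, by the parallel axis theorem.\<close>

lemma G_exchange:
  fixes C :: "'a::real_inner multiset"
  assumes "x \<in># C"
  shows "G (C - {#x#} + {#y#}) = G C - exchange_gain (size C) (mean_mset C) x y"
proof -
  obtain D where D: "C = add_mset x D" using assms by (metis multi_member_split)
  define m where "m = mean_mset C"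
  let ?E = "C - {#x#} + {#y#}"
  have n: "real (size C) > 0" and sz: "size ?E = size C" using D by auto
  have mean: "mean_mset ?E - m = (1 / real (size C)) *\<^sub>R (y - x)"
    using D by (simp add: m_def mean_mset_def flip: scaleR_diff_right)
  have "G ?E = (\<Sum>z\<in>#?E. (norm (z - m))\<^sup>2) - real (size C) * (norm (mean_mset ?E - m))\<^sup>2"
    using sum_mset_sq_dist[of m ?E] sz by (simp add: norm_minus_commute)
  also have "(\<Sum>z\<in>#?E. (norm (z - m))\<^sup>2) = G C - (norm (x - m))\<^sup>2 + (norm (y - m))\<^sup>2"
    using D by (simp add: G_def m_def)
  also have "real (size C) * (norm (mean_mset ?E - m))\<^sup>2 = (norm (x - y))\<^sup>2 / real (size C)"
    unfolding mean using n by (simp add: norm_minus_commute power2_eq_square)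
  finally show ?thesis by (simp add: exchange_gain_def m_def)
qed

text \<open>For \<open>x\<close> farthest from the mean, the first two terms of the gain have a nonnegative
  difference. For \<open>y\<close> farthest from \<open>x\<close>, the last term is large, because \<open>G\<close> is at most the sum of
  squared distances to \<open>x\<close>, which is at most \<open>n |x - y|\<^sup>2\<close>.\<close>

lemma ex_exchange_gain:
  fixes C :: "'a::real_inner multiset"
  assumes "C \<noteq> {#}"
  obtains x y where "x \<in># C" "y \<in># C"
    "exchange_gain (size C) (mean_mset C) x y \<ge> G C / (real (size C))\<^sup>2"
proof -
  let ?m = "mean_mset C" and ?n = "real (size C)"
  have fin: "finite (set_mset C)" "set_mset C \<noteq> {}" using assms by auto
  have max_attained: "\<exists>x\<in>set_mset C. \<forall>z\<in>set_mset C. f z \<le> f x" for f :: "'a \<Rightarrow> real"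
  proof -
    have "Max (f ` set_mset C) \<in> f ` set_mset C" using fin by (intro Max_in) auto
    then obtain x where x: "x \<in># C" "f x = Max (f ` set_mset C)" by force
    have "f z \<le> f x" if "z \<in># C" for z using that x(2) by simp
    with x(1) show ?thesis by blast
  qed
  obtain x where x: "x \<in># C" "\<And>z. z \<in># C \<Longrightarrow> norm (z - ?m) \<le> norm (x - ?m)"
    using max_attained[of "\<lambda>z. norm (z - ?m)"] by blast
  obtain y where y: "y \<in># C" "\<And>z. z \<in># C \<Longrightarrow> norm (z - x) \<le> norm (y - x)"
    using max_attained[of "\<lambda>z. norm (z - x)"] by blast
  have n: "?n > 0" using assms by (simp add: nonempty_has_size)
  have "G C \<le> (\<Sum>z\<in>#C. (norm (z - x))\<^sup>2)"
    by (simp add: sum_mset_sq_dist)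
  also have "\<dots> \<le> (\<Sum>z\<in>#C. (norm (y - x))\<^sup>2)"
    by (intro sum_mset_mono power_mono y) auto
  finally have "G C \<le> ?n * (norm (x - y))\<^sup>2" by (simp add: norm_minus_commute)
  then have "G C / ?n\<^sup>2 \<le> (norm (x - y))\<^sup>2 / ?n"
    using n by (simp add: field_simps power2_eq_square)
  moreover have "(norm (y - ?m))\<^sup>2 \<le> (norm (x - ?m))\<^sup>2"
    by (intro power_mono x y) auto
  ultimately have "G C / ?n\<^sup>2 \<le> exchange_gain (size C) ?m x y"
    unfolding exchange_gain_def by linarith
  with x(1) y(1) show ?thesis by (rule that)
qed

lemma norm_diff_mean_le:
  fixes C :: "'a::real_normed_vector multiset"
  assumes "x \<in># C"
  shows "norm (x - mean_mset C) \<le> sqrt (G C)"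
proof -
  obtain D where D: "C = add_mset x D" using assms by (metis multi_member_split)
  have "(norm (x - mean_mset C))\<^sup>2 \<le> G C"
    using sum_mset_sq_dist_nonneg[of "mean_mset C" D] by (simp add: G_def D)
  then show ?thesis by (simp add: real_le_rsqrt)
qed

text \<open>The deterministic part of the argument. A monotone \<open>G\<close> that does not vanish in the limit stays
  above some \<open>l > 0\<close>, so each configuration offers an exchange between two of its own points with gain
  at least \<open>l / n\<^sup>2\<close>. If the sequence does not escape to infinity, the means and the two points are
  bounded along a subsequence, and Bolzano-Weierstrass yields a limit triple.\<close>

lemma ex_recurrent_gain:
  fixes C :: "nat \<Rightarrow> 'a::euclidean_space multiset"
  assumes n: "n > 0" "\<And>t. size (C t) = n"
    and dec: "decseq (\<lambda>t. G (C t))"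
    and nz: "\<not> (\<lambda>t. G (C t)) \<longlonglongrightarrow> 0"
    and ninf: "\<not> tends_to_infinity C"
  obtains m x y where "exchange_gain n m x y > 0"
    "\<And>U V W. open U \<Longrightarrow> m \<in> U \<Longrightarrow> open V \<Longrightarrow> x \<in> V \<Longrightarrow> open W \<Longrightarrow> y \<in> W \<Longrightarrow>
       \<exists>\<^sub>F t in sequentially. mean_mset (C t) \<in> U \<and> set_mset (C t) \<inter> V \<noteq> {} \<and> set_mset (C t) \<inter> W \<noteq> {}"
proof -
  have ne: "C t \<noteq> {#}" for t using n(1) n(2)[of t] by auto
  obtain l where l: "(\<lambda>t. G (C t)) \<longlonglongrightarrow> l" "\<And>t. l \<le> G (C t)"
    using decseq_convergent[OF dec, of 0] G_nonneg by metis
  have "l \<ge> 0" by (rule LIMSEQ_le_const[OF l(1)]) (auto intro: G_nonneg)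
  with nz l(1) have l0: "l > 0" by (metis less_eq_real_def)
  define X where "X t = (SOME x. x \<in># C t \<and> (\<exists>y. y \<in># C t \<and>
      exchange_gain n (mean_mset (C t)) x y \<ge> l / (real n)\<^sup>2))" for t
  define Y where "Y t = (SOME y. y \<in># C t \<and> exchange_gain n (mean_mset (C t)) (X t) y \<ge> l / (real n)\<^sup>2)" for t
  have "\<exists>x. x \<in># C t \<and> (\<exists>y. y \<in># C t \<and> exchange_gain n (mean_mset (C t)) x y \<ge> l / (real n)\<^sup>2)" for t
  proof -
    obtain x y where *: "x \<in># C t" "y \<in># C t"
        "exchange_gain n (mean_mset (C t)) x y \<ge> G (C t) / (real n)\<^sup>2"
      using ex_exchange_gain[OF ne[of t]] n by metis
    moreover have "G (C t) / (real n)\<^sup>2 \<ge> l / (real n)\<^sup>2"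
      using l(2) by (simp add: divide_right_mono)
    ultimately show ?thesis by (meson order_trans)
  qed
  from someI_ex[OF this] have X: "X t \<in># C t"
    "\<exists>y. y \<in># C t \<and> exchange_gain n (mean_mset (C t)) (X t) y \<ge> l / (real n)\<^sup>2" for t
    unfolding X_def by auto
  from someI_ex[OF X(2)] have Y: "Y t \<in># C t"
    "exchange_gain n (mean_mset (C t)) (X t) (Y t) \<ge> l / (real n)\<^sup>2" for t
    unfolding Y_def by auto
  obtain R where "\<not> (\<forall>\<^sub>F t in sequentially. R \<le> Min (norm ` set_mset (C t)))"
    using ninf unfolding tends_to_infinity_def filterlim_at_top by blast
  then have "\<exists>\<^sub>F t in sequentially. Min (norm ` set_mset (C t)) < R"
    by (simp only: not_eventually not_le)
  then have "infinite {t. Min (norm ` set_mset (C t)) < R}"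
    by (simp add: cofinite_eq_sequentially[symmetric] frequently_cofinite)
  then obtain r :: "nat \<Rightarrow> nat" where r: "strict_mono r" "\<And>k. Min (norm ` set_mset (C (r k))) < R"
    using infinite_enumerate by blast
  \<comment> \<open>Every configuration lies within \<open>s\<close> of its mean, so one point of norm below \<open>R\<close> bounds them all.\<close>
  define s where "s = sqrt (G (C 0))"
  have s: "norm (z - mean_mset (C t)) \<le> s" if "z \<in># C t" for z t
    using norm_diff_mean_le[OF that] decseqD[OF dec, of 0 t] unfolding s_def
    by (meson order_trans real_sqrt_le_mono zero_le)
  have mean_bd: "norm (mean_mset (C (r k))) \<le> R + s" for k
  proof -
    have "Min (norm ` set_mset (C (r k))) \<in> norm ` set_mset (C (r k))"
      using ne by (intro Min_in) auto
    then obtain z where "z \<in># C (r k)" "norm z < R" using r(2)[of k] by auto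
    then show ?thesis using s[of z "r k"] norm_triangle_ineq3[of z "mean_mset (C (r k))"] by linarith
  qed
  have pt_bd: "norm z \<le> R + 2 * s" if "z \<in># C (r k)" for z k
    using mean_bd[of k] s[OF that] norm_triangle_ineq2[of z "mean_mset (C (r k))"] by linarith
  have "bounded (range (\<lambda>k. (mean_mset (C (r k)), X (r k), Y (r k))))"
  proof (rule bounded_subset)
    show "bounded (cball (0::'a) (R + s) \<times> cball (0::'a) (R + 2 * s) \<times> cball (0::'a) (R + 2 * s))"
      by (intro bounded_Times bounded_cball)
    show "range (\<lambda>k. (mean_mset (C (r k)), X (r k), Y (r k)))
       \<subseteq> cball 0 (R + s) \<times> cball 0 (R + 2 * s) \<times> cball 0 (R + 2 * s)"
      using mean_bd pt_bd[OF X(1)] pt_bd[OF Y(1)] by auto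
  qed
  from bounded_imp_convergent_subsequence[OF this]
  obtain p q where q: "strict_mono q"
     and lim: "((\<lambda>k. (mean_mset (C (r k)), X (r k), Y (r k))) \<circ> q) \<longlonglongrightarrow> p" by blast
  obtain m x y where p: "p = (m, x, y)" by (cases p)
  define u where "u = r \<circ> q"
  have u: "strict_mono u" using r(1) q by (auto simp: u_def strict_mono_o)
  have lm: "(\<lambda>k. mean_mset (C (u k))) \<longlonglongrightarrow> m"
    using tendsto_fst[OF lim] by (simp add: p u_def o_def)
  have lx: "(\<lambda>k. X (u k)) \<longlonglongrightarrow> x"
    using tendsto_fst[OF tendsto_snd[OF lim]] by (simp add: p u_def o_def)
  have ly: "(\<lambda>k. Y (u k)) \<longlonglongrightarrow> y"
    using tendsto_snd[OF tendsto_snd[OF lim]] by (simp add: p u_def o_def)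
  have "(\<lambda>k. exchange_gain n (mean_mset (C (u k))) (X (u k)) (Y (u k))) \<longlonglongrightarrow> exchange_gain n m x y"
    unfolding exchange_gain_def using n by (intro tendsto_intros lm lx ly) auto
  then have "l / (real n)\<^sup>2 \<le> exchange_gain n m x y"
    by (rule LIMSEQ_le_const) (auto intro: Y)
  then have "exchange_gain n m x y > 0" using l0 n
    by (smt (verit) divide_pos_pos of_nat_0_less_iff zero_less_power)
  moreover have "\<exists>\<^sub>F t in sequentially. mean_mset (C t) \<in> U \<and> set_mset (C t) \<inter> V \<noteq> {} \<and> set_mset (C t) \<inter> W \<noteq> {}"
    if o: "open U" "m \<in> U" "open V" "x \<in> V" "open W" "y \<in> W" for U V W
  proof -
    have "\<forall>\<^sub>F k in sequentially. mean_mset (C (u k)) \<in> U \<and> X (u k) \<in> V \<and> Y (u k) \<in> W"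
      by (intro eventually_conj topological_tendstoD[OF lm] topological_tendstoD[OF lx] topological_tendstoD[OF ly] o)
    then have "\<forall>\<^sub>F k in sequentially. mean_mset (C (u k)) \<in> U \<and> set_mset (C (u k)) \<inter> V \<noteq> {} \<and> set_mset (C (u k)) \<inter> W \<noteq> {}"
      by eventually_elim (use X(1) Y(1) in blast)
    then have "\<exists>\<^sub>F k in sequentially. mean_mset (C (u k)) \<in> U \<and> set_mset (C (u k)) \<inter> V \<noteq> {} \<and> set_mset (C (u k)) \<inter> W \<noteq> {}"
      by (intro eventually_frequently) auto
    then show ?thesis
      using filterlim_subseq[OF u] unfolding frequently_def
      by (auto simp: filterlim_iff)
  qed
  ultimately show ?thesis by (rule that)
qed


section \<open>Supports and the filtration\<close>

text \<open>The complement of the support is covered by the basic open sets of probability zero, and these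
  are countably many.\<close>

lemma AE_in_rv_support:
  fixes \<zeta> :: "'p \<Rightarrow> 'a::euclidean_space"
  assumes "prob_space P" and \<zeta> [measurable]: "\<zeta> \<in> borel_measurable P"
    and Y [measurable]: "Y \<in> borel_measurable M" and eq: "distr M borel Y = distr P borel \<zeta>"
  shows "AE \<omega> in M. Y \<omega> \<in> rv_support P \<zeta>"
proof -
  interpret P: prob_space P by fact
  obtain \<B> :: "'a set set" where \<B>: "countable \<B>" "topological_basis \<B>"
    using ex_countable_basis by blast
  have "AE \<omega> in M. \<P>(p in P. \<zeta> p \<in> W) = 0 \<longrightarrow> Y \<omega> \<notin> W" if "W \<in> \<B>" for W
  proof (cases "\<P>(p in P. \<zeta> p \<in> W) = 0")
    case True
    have [measurable]: "W \<in> sets borel" using topological_basis_open[OF \<B>(2) that] by simp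
    have "AE p in P. \<zeta> p \<notin> W" using True by (subst (asm) P.prob_Collect_eq_0) auto
    then have "AE x in distr P borel \<zeta>. x \<notin> W" by (subst AE_distr_iff) auto
    then have "AE x in distr M borel Y. x \<notin> W" unfolding eq .
    then have "AE \<omega> in M. Y \<omega> \<notin> W" by (subst (asm) AE_distr_iff) auto
    then show ?thesis by simp
  qed simp
  then have "AE \<omega> in M. \<forall>W\<in>\<B>. \<P>(p in P. \<zeta> p \<in> W) = 0 \<longrightarrow> Y \<omega> \<notin> W"
    using \<B>(1) by (simp add: AE_ball_countable)
  then show ?thesis
  proof eventually_elim
    case (elim \<omega>)
    show ?case unfolding rv_support_def
    proof (intro CollectI allI impI)
      fix e :: real assume "e > 0"
      then obtain W where W: "W \<in> \<B>" "Y \<omega> \<in> W" "W \<subseteq> ball (Y \<omega>) e"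
        using topological_basisE[OF \<B>(2) open_ball, of "Y \<omega>" "Y \<omega>" e] by auto
      then have "0 < \<P>(p in P. \<zeta> p \<in> W)" using elim by (auto simp: less_le)
      also have "\<dots> \<le> \<P>(p in P. \<zeta> p \<in> ball (Y \<omega>) e)"
        using W(3) by (intro P.finite_measure_mono) auto
      finally show "0 < \<P>(p in P. \<zeta> p \<in> ball (Y \<omega>) e)" .
    qed
  qed
qed

lemma space_history [simp]: "space (history M K X C Z t u) = space M"
  by (simp add: history_def space_measure_of_conv)

lemma space_future [simp]: "space (future M K Z t) = space M"
  by (simp add: future_def space_measure_of_conv)

lemma vimage_algebra_into_space: "x \<in> A \<Longrightarrow> A \<in> sets (vimage_algebra \<Omega> f N) \<Longrightarrow> x \<in> \<Omega>"
  using sets.sets_into_space[of A "vimage_algebra \<Omega> f N"] by auto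

lemma measurable_history_core:
  fixes C :: "nat \<Rightarrow> 'w \<Rightarrow> 'a::topological_space multiset"
  assumes "s < u"
  shows "C s \<in> history M K X C Z t u \<rightarrow>\<^sub>M config_space"
proof (rule measurableI)
  let ?F = "sets (vimage_algebra (space M) (X 0) config_space)
      \<union> (\<Union>s\<in>{1..t}. \<Union>j\<in>{1..K}. sets (vimage_algebra (space M) (Z s j) borel))
      \<union> (\<Union>s\<in>{..<u}. sets (vimage_algebra (space M) (C s) config_space))"
  have F: "?F \<subseteq> Pow (space M)"
    by (auto dest: vimage_algebra_into_space)
  fix A :: "'a multiset set" assume "A \<in> sets config_space"
  then have "C s -` A \<inter> space M \<in> ?F" using assms by (blast intro: in_vimage_algebra)
  then show "C s -` A \<inter> space (history M K X C Z t u) \<in> sets (history M K X C Z t u)"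
    using F by (simp add: history_def sigma_sets.Basic)
qed simp

lemma measurable_future_new:
  fixes Z :: "nat \<Rightarrow> nat \<Rightarrow> 'w \<Rightarrow> 'a::topological_space"
  assumes "t < s" "j \<in> {1..K}"
  shows "Z s j \<in> future M K Z t \<rightarrow>\<^sub>M borel"
proof (rule measurableI)
  let ?F = "\<Union>s\<in>{t<..}. \<Union>j\<in>{1..K}. sets (vimage_algebra (space M) (Z s j) borel)"
  have F: "?F \<subseteq> Pow (space M)"
    by (auto dest: vimage_algebra_into_space)
  fix A :: "'a set" assume "A \<in> sets borel"
  then have "Z s j -` A \<inter> space M \<in> ?F" using assms by (blast intro: in_vimage_algebra)
  then show "Z s j -` A \<inter> space (future M K Z t) \<in> sets (future M K Z t)"
    using F by (simp add: future_def sigma_sets.Basic)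
qed simp

lemma coresD:
  assumes "C \<in> cores n X"
  shows "C \<subseteq># X" "size C = n" "\<And>D. D \<subseteq># X \<Longrightarrow> size D = n \<Longrightarrow> G C \<le> G D"
  using assms by (auto simp: cores_def is_arg_min_def not_less)

section \<open>Almost sure behaviour of the process\<close>

locale jante_process_nondegenerate = jante_process M P \<zeta> N K X C Z
  for M :: "'w measure" and P :: "'p measure" and \<zeta> :: "'p \<Rightarrow> 'a::euclidean_space"
    and N K :: nat
    and X C :: "nat \<Rightarrow> 'w \<Rightarrow> 'a multiset" and Z :: "nat \<Rightarrow> nat \<Rightarrow> 'w \<Rightarrow> 'a" +
  assumes prob_space_P: "prob_space P"
    and measurable_\<zeta> [measurable]: "\<zeta> \<in> borel_measurable P"
    and K_pos: "1 \<le> K"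
    and K_less: "K < N"
begin

lemma measurable_core_M [measurable]: "C t \<in> M \<rightarrow>\<^sub>M config_space"
  by (rule measurable_core)

lemma AE_core: "AE \<omega> in M. \<forall>t. C t \<omega> \<in> cores (N - K) (X t \<omega>)"
  using core by (simp add: AE_all_countable)

lemma AE_size_core: "AE \<omega> in M. \<forall>t. size (C t \<omega>) = N - K"
  using AE_core by eventually_elim (auto dest: coresD)

text \<open>Exchanging \<open>x\<close> for the first of the new points gives a subconfiguration of the right size, which
  competes with the new core.\<close>

lemma AE_core_exchange:
  "AE \<omega> in M. \<forall>t. \<forall>x \<in># C t \<omega>. G (C (Suc t) \<omega>)
      \<le> G (C t \<omega>) - exchange_gain (N - K) (mean_mset (C t \<omega>)) x (Z (Suc t) 1 \<omega>)"
  using AE_core AE_space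
proof eventually_elim
  case (elim \<omega>)
  show ?case
  proof (intro allI ballI)
    fix t x assume x: "x \<in># C t \<omega>"
    let ?y = "Z (Suc t) 1 \<omega>"
    let ?D = "C t \<omega> - {#x#} + {#?y#}"
    have "?y \<in># image_mset (\<lambda>j. Z (Suc t) j \<omega>) (mset_set {1..K})"
      using K_pos by auto
    then have "{#?y#} \<subseteq># image_mset (\<lambda>j. Z (Suc t) j \<omega>) (mset_set {1..K})" by simp
    then have "?D \<subseteq># X (Suc t) \<omega>"
      unfolding step[OF elim(2)] by (intro subset_mset.add_mono) auto
    moreover have sz: "size (C t \<omega>) = N - K" using elim(1) coresD by blast
    then have "size ?D = N - K" using x by (metis insert_DiffM size_add_mset union_commute add_mset_add_single)
    ultimately have "G (C (Suc t) \<omega>) \<le> G ?D" using elim(1) coresD(3) by blast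
    then show "G (C (Suc t) \<omega>)
        \<le> G (C t \<omega>) - exchange_gain (N - K) (mean_mset (C t \<omega>)) x ?y"
      unfolding G_exchange[OF x] sz .
  qed
qed

lemma AE_decseq: "AE \<omega> in M. decseq (\<lambda>t. G (C t \<omega>))"
  using AE_core AE_space
proof eventually_elim
  case (elim \<omega>)
  show ?case
  proof (rule decseq_SucI)
    fix t
    have "C t \<omega> \<subseteq># X (Suc t) \<omega>" by (simp add: step[OF elim(2)])
    then show "G (C (Suc t) \<omega>) \<le> G (C t \<omega>)" using elim(1) coresD by blast
  qed
qed

lemma AE_core_in_support: "AE \<omega> in M. \<forall>t. set_mset (C t \<omega>) \<subseteq> rv_support P \<zeta>"
proof -
  have "AE \<omega> in M. Z (Suc t) j \<omega> \<in> rv_support P \<zeta>" if "j \<in> {1..K}" for t j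
    by (intro AE_in_rv_support prob_space_P measurable_\<zeta> measurable_new distr_new) (use that in auto)
  then have "AE \<omega> in M. \<forall>t. \<forall>j\<in>{1..K}. Z (Suc t) j \<omega> \<in> rv_support P \<zeta>"
    by (simp add: AE_all_countable AE_ball_countable)
  then show ?thesis using AE_core AE_space init
  proof eventually_elim
    case (elim \<omega>)
    have C: "set_mset (C t \<omega>) \<subseteq> set_mset (X t \<omega>)" for t
      using elim(2) coresD(1) set_mset_mono by blast
    have "set_mset (X t \<omega>) \<subseteq> rv_support P \<zeta>" for t
    proof (induction t)
      case (Suc t)
      then show ?case using C[of t] elim(1) by (auto simp: step[OF elim(3)])
    qed (use elim(4) in simp)
    with C show ?case by blast
  qed
qed

text \<open>Call it a visit when the mean is in \<open>U\<close> and the core meets \<open>V\<close>. Each visit followed by a new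
  point in \<open>W\<close> takes at least \<open>\<delta>\<close> from the finite budget \<open>G (C 0)\<close>, and each visit is
  followed by such a point with the same probability, independently of the past. Hence the visits
  have summable probabilities, as long as the budget is bounded.\<close>

lemma AE_eventually_avoids:
  assumes "open U" "open V" "open W" and "\<delta> > 0"
    and gain: "\<And>m x y. m \<in> U \<Longrightarrow> x \<in> V \<Longrightarrow> y \<in> W \<Longrightarrow> \<delta> \<le> exchange_gain (N - K) m x y"
    and pos: "\<P>(p in P. \<zeta> p \<in> W) > 0"
  shows "AE \<omega> in M. \<forall>\<^sub>F t in sequentially.
    \<not> (mean_mset (C t \<omega>) \<in> U \<and> set_mset (C t \<omega>) \<inter> V \<noteq> {})"
proof -
  \<comment> \<open>\<open>G (C 0)\<close> may fail to be integrable; cutting off at \<open>L\<close> keeps the expected number of drops finite.\<close>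
  define Q where "Q = mean_mset -` U \<inter> {X :: 'a multiset. set_mset X \<inter> V \<noteq> {}}"
  define B where "B L t = (C t -` Q \<inter> space M) \<inter> (C 0 -` (G -` {..real L}) \<inter> space M)" for L t
  define H where "H t = Z (Suc t) 1 -` W \<inter> space M" for t
  define p where "p = \<P>(p in P. \<zeta> p \<in> W)"
  have Q: "Q \<in> sets config_space"
    using measurable_sets[OF measurable_mean_mset, of U] measurable_meets[of V] assms(1,2)
    by (auto simp: Q_def)
  have GL: "G -` {..real L} \<in> sets (config_space :: 'a multiset measure)" for L
    using measurable_sets[OF measurable_G, of "{..real L}"] by simp
  have B: "B L t \<in> sets (history M K X C Z t (Suc t))" for L t
  proof -
    have "C s -` A \<inter> space M \<in> sets (history M K X C Z t (Suc t))" if "A \<in> sets config_space" "s \<le> t" for A s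
      using measurable_sets[OF measurable_history_core that(1), of s "Suc t" C M K X Z t] that(2)
      by simp
    then show ?thesis unfolding B_def using Q GL by auto
  qed
  have H: "H t \<in> sets (future M K Z t)" for t
    using measurable_sets[OF measurable_future_new, of t "Suc t" 1 K W Z M] K_pos \<open>open W\<close>
    by (simp add: H_def)
  have B_events [measurable]: "B L t \<in> events" for L t
    using B indep_setD_ev1[OF indep_history] by blast
  have H_events [measurable]: "H t \<in> events" for t
    using H indep_setD_ev2[OF indep_history] by blast
  have prob_H: "prob (H t) = p" for t
  proof -
    have "prob (H t) = measure (distr M borel (Z (Suc t) 1)) W"
      using K_pos \<open>open W\<close> by (subst measure_distr) (auto simp: H_def intro!: measurable_new)
    also have "\<dots> = measure (distr P borel \<zeta>) W"
      using K_pos by (subst distr_new) auto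
    also have "\<dots> = p" using \<open>open W\<close>
      by (subst measure_distr) (auto simp: p_def intro!: arg_cong[where f = "measure P"])
    finally show ?thesis .
  qed
  have partial: "(\<Sum>t<T. prob (B L t \<inter> H t)) \<le> real L / \<delta>" for L T
  proof -
    have "AE \<omega> in M. (\<Sum>t<T. indicator (B L t \<inter> H t) \<omega>) \<le> real L / \<delta>"
      using AE_core_exchange AE_decseq
    proof eventually_elim
      case (elim \<omega>)
      show ?case
      proof (cases "G (C 0 \<omega>) \<le> real L")
        case True
        have "\<delta> * (\<Sum>t<T. indicator (B L t \<inter> H t) \<omega>) \<le> G (C 0 \<omega>) - G (C T \<omega>)"
        proof (induction T)
          case (Suc T)
          have "\<delta> * indicator (B L T \<inter> H T) \<omega> \<le> G (C T \<omega>) - G (C (Suc T) \<omega>)"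
          proof (cases "\<omega> \<in> B L T \<inter> H T")
            case True
            then obtain x where x: "x \<in># C T \<omega>" "x \<in> V" "mean_mset (C T \<omega>) \<in> U" "Z (Suc T) 1 \<omega> \<in> W"
              by (auto simp: B_def H_def Q_def)
            with gain[OF x(3) x(2) x(4)] elim(1)[rule_format, OF x(1)] True show ?thesis by simp
          next
            case False
            then show ?thesis using decseqD[OF elim(2), of T "Suc T"] by simp
          qed
          then show ?case using Suc by (simp add: distrib_left)
        qed simp
        also have "\<dots> \<le> real L" using True G_nonneg[of "C T \<omega>"] by linarith
        finally show ?thesis using \<open>\<delta> > 0\<close> by (simp add: field_simps)
      next
        case False
        then have "\<omega> \<notin> B L t" for t by (simp add: B_def)
        then show ?thesis using \<open>\<delta> > 0\<close> by simp
      qed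
    qed
    then have "(\<integral>\<omega>. (\<Sum>t<T. indicator (B L t \<inter> H t) \<omega>) \<partial>M) \<le> real L / \<delta>"
      by (intro integral_le_const Bochner_Integration.integrable_sum integrable_real_indicator)
        (auto simp: emeasure_eq_measure)
    also have "(\<integral>\<omega>. (\<Sum>t<T. indicator (B L t \<inter> H t) \<omega>) \<partial>M) = (\<Sum>t<T. prob (B L t \<inter> H t))"
      by (subst Bochner_Integration.integral_sum) (auto simp: emeasure_eq_measure)
    finally show ?thesis .
  qed
  have "AE \<omega> in M. \<forall>\<^sub>F t in sequentially. \<omega> \<in> space M - B L t" for L
  proof (rule borel_cantelli_AE1)
    have "summable (\<lambda>t. prob (B L t \<inter> H t))"
      by (rule summableI_nonneg_bounded[OF _ partial]) simp
    then have "summable (\<lambda>t. prob (B L t) * p)"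
      by (simp add: indep_setD[OF indep_history B H] prob_H)
    from summable_mult2[OF this, of "1 / p"] show "summable (\<lambda>t. prob (B L t))"
      using pos by (simp add: p_def)
  qed (auto simp: emeasure_eq_measure)
  then have "AE \<omega> in M. \<forall>L. \<forall>\<^sub>F t in sequentially. \<omega> \<in> space M - B L t"
    by (simp add: AE_all_countable)
  then show ?thesis using AE_space
  proof eventually_elim
    case (elim \<omega>)
    obtain L where "G (C 0 \<omega>) \<le> real L" using real_arch_simple by blast
    with elim(2) have "\<omega> \<in> B L t" if "mean_mset (C t \<omega>) \<in> U \<and> set_mset (C t \<omega>) \<inter> V \<noteq> {}" for t
      using that by (auto simp: B_def Q_def)
    then show ?case
      by (intro eventually_mono[OF spec[OF elim(1), of L]]) blast
  qed
qed

text \<open>The recurrent triple \<open>(m, x, y)\<close> depends on the path, so \<open>AE_eventually_avoids\<close> has to hold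
  simultaneously for all relevant neighbourhoods; a countable base of the topology makes this
  possible.\<close>

lemma AE_G_null_or_tends_to_infinity:
  "AE \<omega> in M. (\<lambda>t. G (C t \<omega>)) \<longlonglongrightarrow> 0 \<or> tends_to_infinity (\<lambda>t. C t \<omega>)"
proof -
  obtain \<B> :: "'a set set" where \<B>: "countable \<B>" "topological_basis \<B>"
    using ex_countable_basis by blast
  define productive where "productive U V W \<longleftrightarrow>
    (\<exists>\<delta>>0. \<forall>m\<in>U. \<forall>x\<in>V. \<forall>y\<in>W. \<delta> \<le> exchange_gain (N - K) m x y) \<and> \<P>(p in P. \<zeta> p \<in> W) > 0" for U V W
  have "AE \<omega> in M. productive U V W \<longrightarrow> (\<forall>\<^sub>F t in sequentially.
      \<not> (mean_mset (C t \<omega>) \<in> U \<and> set_mset (C t \<omega>) \<inter> V \<noteq> {}))"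
    if "U \<in> \<B>" "V \<in> \<B>" "W \<in> \<B>" for U V W
  proof (cases "productive U V W")
    case True
    then obtain \<delta> where "\<delta> > 0" "\<forall>m\<in>U. \<forall>x\<in>V. \<forall>y\<in>W. \<delta> \<le> exchange_gain (N - K) m x y"
        "\<P>(p in P. \<zeta> p \<in> W) > 0"
      by (auto simp: productive_def)
    then have "AE \<omega> in M. (\<forall>\<^sub>F t in sequentially.
      \<not> (mean_mset (C t \<omega>) \<in> U \<and> set_mset (C t \<omega>) \<inter> V \<noteq> {}))"
      using that \<B>(2) by (intro AE_eventually_avoids[of U V W \<delta>] topological_basis_open) auto
    then show ?thesis by simp
  qed simp
  then have "AE \<omega> in M. \<forall>U\<in>\<B>. \<forall>V\<in>\<B>. \<forall>W\<in>\<B>. productive U V W \<longrightarrow> (\<forall>\<^sub>F t in sequentially.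
      \<not> (mean_mset (C t \<omega>) \<in> U \<and> set_mset (C t \<omega>) \<inter> V \<noteq> {}))"
    by (simp only: AE_ball_countable[OF \<B>(1)]) blast
  then show ?thesis using AE_size_core AE_decseq AE_core_in_support
  proof eventually_elim
    case (elim \<omega>)
    show ?case
    proof (rule ccontr)
      assume "\<not> ?thesis"
      then obtain m x y where gain: "exchange_gain (N - K) m x y > 0"
        and rec: "\<And>U V W. open U \<Longrightarrow> m \<in> U \<Longrightarrow> open V \<Longrightarrow> x \<in> V \<Longrightarrow> open W \<Longrightarrow> y \<in> W \<Longrightarrow>
          \<exists>\<^sub>F t in sequentially. mean_mset (C t \<omega>) \<in> U \<and> set_mset (C t \<omega>) \<inter> V \<noteq> {}
            \<and> set_mset (C t \<omega>) \<inter> W \<noteq> {}"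
        using ex_recurrent_gain[of "N - K" "\<lambda>t. C t \<omega>"] elim(2,3) K_less by auto
      define \<delta> where "\<delta> = exchange_gain (N - K) m x y / 2"
      have "\<delta> > 0" "\<delta> < exchange_gain (N - K) m x y" using gain by (auto simp: \<delta>_def)
      let ?S = "{q. \<delta> < exchange_gain (N - K) (fst q) (fst (snd q)) (snd (snd q))}"
      have "open ?S" unfolding exchange_gain_def divide_inverse
        by (intro open_Collect_less continuous_intros)
      moreover have "(m, x, y) \<in> ?S" using \<open>\<delta> < _\<close> by simp
      ultimately obtain U T where UT: "open U" "open T" "m \<in> U" "(x, y) \<in> T" "U \<times> T \<subseteq> ?S"
        by (rule open_prod_elim) auto
      obtain V W where VW: "open V" "open W" "x \<in> V" "y \<in> W" "V \<times> W \<subseteq> T"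
        using open_prod_elim[OF UT(2,4)] by (metis mem_Sigma_iff)
      obtain U' where U': "U' \<in> \<B>" "m \<in> U'" "U' \<subseteq> U" using topological_basisE[OF \<B>(2) UT(1,3)] .
      obtain V' where V': "V' \<in> \<B>" "x \<in> V'" "V' \<subseteq> V" using topological_basisE[OF \<B>(2) VW(1,3)] .
      obtain W' where W': "W' \<in> \<B>" "y \<in> W'" "W' \<subseteq> W" using topological_basisE[OF \<B>(2) VW(2,4)] .
      have o: "open U'" "open V'" "open W'" using topological_basis_open[OF \<B>(2)] U' V' W' by auto
      have freq: "\<exists>\<^sub>F t in sequentially. mean_mset (C t \<omega>) \<in> U' \<and> set_mset (C t \<omega>) \<inter> V' \<noteq> {}
            \<and> set_mset (C t \<omega>) \<inter> W' \<noteq> {}"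
        by (rule rec) (use o U' V' W' in auto)
      \<comment> \<open>\<open>\<zeta>\<close> hits \<open>W'\<close> with positive probability, since the core has visited \<open>W'\<close>
        and consists of points of the support.\<close>
      then obtain t z where "z \<in># C t \<omega>" "z \<in> W'" by (auto dest!: frequently_ex)
      then have z: "z \<in> rv_support P \<zeta>" "z \<in> W'" using elim(4) by auto
      then obtain e where e: "e > 0" "ball z e \<subseteq> W'" using o(3) open_contains_ball by blast
      interpret P: prob_space P by (rule prob_space_P)
      have "0 < \<P>(p in P. \<zeta> p \<in> ball z e)" using z(1) e(1) by (simp add: rv_support_def)
      also have "\<dots> \<le> \<P>(p in P. \<zeta> p \<in> W')"
        using e(2) measurable_sets[OF measurable_\<zeta> borel_open[OF o(3)]]
        by (intro P.finite_measure_mono) (auto simp: vimage_def Int_def conj_commute)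
      finally have "0 < \<P>(p in P. \<zeta> p \<in> W')" .
      moreover have "\<delta> \<le> exchange_gain (N - K) m' x' y'" if "m' \<in> U'" "x' \<in> V'" "y' \<in> W'" for m' x' y'
      proof -
        have "(m', x', y') \<in> ?S" using that U'(3) V'(3) W'(3) VW(5) UT(5) by blast
        then show ?thesis by simp
      qed
      ultimately have "productive U' V' W'" using \<open>\<delta> > 0\<close> unfolding productive_def by blast
      with elim(1) U'(1) V'(1) W'(1) have "\<forall>\<^sub>F t in sequentially.
          \<not> (mean_mset (C t \<omega>) \<in> U' \<and> set_mset (C t \<omega>) \<inter> V' \<noteq> {})" by blast
      then have "\<forall>\<^sub>F t in sequentially. \<not> (mean_mset (C t \<omega>) \<in> U' \<and> set_mset (C t \<omega>) \<inter> V' \<noteq> {}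
            \<and> set_mset (C t \<omega>) \<inter> W' \<noteq> {})"
        by (rule eventually_mono) blast
      with freq show False unfolding frequently_def by blast
    qed
  qed
qed

lemma AE_G_null_if_compact_support:
  assumes "compact (rv_support P \<zeta>)"
  shows "AE \<omega> in M. (\<lambda>t. G (C t \<omega>)) \<longlonglongrightarrow> 0"
  using AE_G_null_or_tends_to_infinity AE_size_core AE_core_in_support
proof eventually_elim
  case (elim \<omega>)
  obtain R where R: "\<And>x. x \<in> rv_support P \<zeta> \<Longrightarrow> norm x \<le> R"
    using compact_imp_bounded[OF assms] by (auto simp: bounded_iff)
  have "Min (norm ` set_mset (C t \<omega>)) \<le> R" for t
  proof -
    have "C t \<omega> \<noteq> {#}" using elim(2)[rule_format, of t] K_less by auto
    then obtain x where "x \<in># C t \<omega>" by blast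
    then show ?thesis using R elim(3) by (meson Min_le finite_imageI finite_set_mset imageI order_trans subsetD)
  qed
  moreover have "\<exists>t. R + 1 \<le> Min (norm ` set_mset (C t \<omega>))" if "tends_to_infinity (\<lambda>t. C t \<omega>)"
    using that unfolding tends_to_infinity_def filterlim_at_top eventually_sequentially by blast
  ultimately show ?case using elim(1) by (smt (verit))
qed

text \<open>An almost sure statement about a set that is not an event would not determine its probability.\<close>

lemma sets_G_null_or_tends_to_infinity:
  "{\<omega> \<in> space M. (\<lambda>t. G (C t \<omega>)) \<longlonglongrightarrow> 0 \<or> tends_to_infinity (\<lambda>t. C t \<omega>)} \<in> events"
proof -
  have "{\<omega> \<in> space M. (\<lambda>t. G (C t \<omega>)) \<longlonglongrightarrow> 0} \<in> events"
    by measurable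
  moreover have "tends_to_infinity (\<lambda>t. C t \<omega>) \<longleftrightarrow>
      (\<forall>k::nat. \<exists>t0. \<forall>t\<ge>t0. real k \<le> Min (norm ` set_mset (C t \<omega>)))" for \<omega>
    unfolding tends_to_infinity_def filterlim_at_top eventually_sequentially
    by (meson order_trans real_arch_simple)
  then have "{\<omega> \<in> space M. tends_to_infinity (\<lambda>t. C t \<omega>)} \<in> events"
    by simp measurable
  ultimately show ?thesis by (simp add: Collect_disj_eq conj_disj_distribL)
qed

end

theorem theorem1:
  fixes M :: "'w measure" and P :: "'p measure" and \<zeta> :: "'p \<Rightarrow> 'a::euclidean_space"
    and N K :: nat
    and X C :: "nat \<Rightarrow> 'w \<Rightarrow> 'a multiset" and Z :: "nat \<Rightarrow> nat \<Rightarrow> 'w \<Rightarrow> 'a"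
  assumes "prob_space P" and "\<zeta> \<in> borel_measurable P"
    and "N \<ge> 3" and "1 \<le> K" and "K \<le> N - 2"
    and "jante_process M P \<zeta> N K X C Z"
  shows "\<P>(\<omega> in M. ((\<lambda>t. G (C t \<omega>)) \<longlonglongrightarrow> 0) \<or> tends_to_infinity (\<lambda>t. C t \<omega>)) = 1
    \<and> (compact (rv_support P \<zeta>) \<longrightarrow> (AE \<omega> in M. (\<lambda>t. G (C t \<omega>)) \<longlonglongrightarrow> 0))"
proof -
  have "K < N" using assms(3,5) by linarith
  then interpret jante_process_nondegenerate M P \<zeta> N K X C Z
    by (intro jante_process_nondegenerate.intro jante_process_nondegenerate_axioms.intro assms)
  show ?thesis
    using prob_Collect_eq_1[OF sets_G_null_or_tends_to_infinity] AE_G_null_or_tends_to_infinity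
      AE_G_null_if_compact_support by blast
qed

end
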